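(* Let $n \in \mathbb{N}$. Then $$\frac{2^{2n+1}}{(n-1)!}\left[\frac{n^2}{16}\sum_{k=0}^{n-1} \left(-\frac{1}{2}\right)^k P_k\left(n-1, \frac{n}{2}\right) \left(\zeta\left(k-n+2, \frac{n}{4}\right) -\zeta\left(k-n+2, \frac{n+2}{4}\right)\right) - \sum_{k=0}^{n+1} \left(-\frac{1}{2}\right)^k P_k\left(n+1, \frac{n+2}{2}\right) \left(\zeta\left(k-n, \frac{n+2}{4}\right) - \zeta\left(k-n, \frac{n+4}{4}\right)\right)\right] = 0.$$
   Context: $\mathbb{N}=\{1,2,3,\ldots\}$. $(a)_n := a(a+1)\cdots(a+n-1)$ is the rising factorial, with $(a)_0=1$. Signed generalized Stirling polynomials of the first kind: for $m\in\mathbb{N}_0$ and $x\in\mathbb{C}$, $P_k(m,x)$, $0\le k\le m$, are defined by the polynomial identity in $j$ $$(j+1)_m = \sum_{k=0}^m (-1)^k P_k(m, x)\,(j + x)^{m-k}.$$ $\zeta(s,z)$ is the Hurwitz zeta function, $\zeta(s,z)=\sum_{n\ge0}(n+z)^{-s}$ for $\operatorname{Re}s>1$, continued analytically to $s\in\mathbb{C}\setminus\{1\}$. At $s=1$ the differences are understood as limits: $\zeta(1,x)-\zeta\left(1,x+\tfrac12\right):=\lim_{s\to1}\left[\zeta(s,x)-\zeta\left(s,x+\tfrac12\right)\right]$. *)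

theory Defs
  imports "HOL-Complex_Analysis.Complex_Analysis"
begin

text \<open>
  The coefficients \<open>P\<^sub>0(m,x), \<dots>, P\<^sub>m(m,x)\<close>, taken as one sequence vanishing beyond \<open>m\<close>,
  are the ones that satisfy the defining identity in the polynomial ring in the variable \<open>j\<close>:
  \<open>[:1, 1:]\<close> is \<open>j + 1\<close> and \<open>[:x, 1:]\<close> is \<open>j + x\<close>.
\<close>

definition is_stirling_coeffs :: "nat \<Rightarrow> complex \<Rightarrow> (nat \<Rightarrow> complex) \<Rightarrow> bool" where
  "is_stirling_coeffs m x p \<longleftrightarrow>
     pochhammer [:1, 1:] m = (\<Sum>k=0..m. smult ((-1) ^ k * p k) ([:x, 1:] ^ (m - k))) \<and>
     (\<forall>k>m. p k = 0)"

definition stirling_poly :: "nat \<Rightarrow> nat \<Rightarrow> complex \<Rightarrow> complex" where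
  "stirling_poly k m x = (THE p. is_stirling_coeffs m x p) k"

lemma is_stirling_coeffs_stirling_poly:
  "\<exists>!p. is_stirling_coeffs m x p"
  "is_stirling_coeffs m x (\<lambda>k. stirling_poly k m x)"
proof -
  have comp_inv: "pcompose (pcompose p [:- x, 1:]) [:x, 1:] = p" for p :: "complex poly"
    by (simp add: pcompose_assoc [symmetric] pcompose_pCons)
  define q where "q = pcompose (pochhammer [:1, 1::complex:] m) [:- x, 1:]"
  have "degree (pochhammer [:1, 1::complex:] k) \<le> k" for k
  proof (induction k)
    case (Suc k)
    have "degree ([:1, 1:] + of_nat k :: complex poly) \<le> 1"
      by (simp add: of_nat_poly)
    then show ?case
      using Suc degree_mult_le [of "pochhammer [:1, 1::complex:] k" "[:1, 1:] + of_nat k"]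
      by (simp add: pochhammer_Suc)
  qed simp
  then have deg: "degree q \<le> m"
    using degree_pcompose_le [of "pochhammer [:1, 1::complex:] m" "[:- x, 1:]"]
    unfolding q_def by (auto intro: order_trans)
  have pow: "pcompose ([:x, 1:] ^ i) [:- x, 1:] = monom 1 i" for i
  proof (induction i)
    case (Suc i)
    have "pcompose [:x, 1:] [:- x, 1:] = [:0, 1:]"
      by (simp add: pcompose_pCons)
    then have "pcompose ([:x, 1:] ^ Suc i) [:- x, 1:] = [:0, 1:] * monom 1 i"
      by (simp only: power_Suc pcompose_mult Suc.IH)
    then show ?case
      by (simp add: monom_Suc)
  qed (simp add: pcompose_1)
  have iff: "is_stirling_coeffs m x p \<longleftrightarrow> p = (\<lambda>k. if k \<le> m then (-1) ^ k * coeff q (m - k) else 0)"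
    for p
  proof -
    have "pochhammer [:1, 1:] m = (\<Sum>k=0..m. smult ((-1) ^ k * p k) ([:x, 1:] ^ (m - k)))
      \<longleftrightarrow> q = (\<Sum>k=0..m. monom ((-1) ^ k * p k) (m - k))" (is "?l = ?r \<longleftrightarrow> q = ?s")
    proof -
      have "pcompose ?r [:- x, 1:] = ?s"
        by (simp add: pcompose_sum pcompose_smult pow smult_monom)
      moreover have "?l = ?r \<longleftrightarrow> q = pcompose ?r [:- x, 1:]"
        unfolding q_def using inj_eq [OF inj_on_inverseI [where f = "\<lambda>p. pcompose p [:- x, 1:]", OF comp_inv]]
        by (rule sym)
      ultimately show ?thesis
        by (simp only:)
    qed
    also have "(\<Sum>k=0..m. monom ((-1) ^ k * p k) (m - k)) = (\<Sum>i=0..m. monom ((-1) ^ (m - i) * p (m - i)) i)"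
      by (rule sum.reindex_bij_witness [where i = "\<lambda>i. m - i" and j = "\<lambda>i. m - i"]) auto
    also have "q = \<dots> \<longleftrightarrow> (\<forall>i\<le>m. coeff q i = (-1) ^ (m - i) * p (m - i))"
      using deg by (auto simp: poly_eq_iff coeff_sum coeff_eq_0 sum.delta if_distrib cong: if_cong)
    also have "\<dots> \<longleftrightarrow> (\<forall>k\<le>m. coeff q (m - k) = (-1) ^ k * p k)"
    proof -
      have "(\<forall>i\<le>m. R i (m - i)) \<longleftrightarrow> (\<forall>k\<le>m. R (m - k) k)" for R :: "nat \<Rightarrow> nat \<Rightarrow> bool"
        by (metis diff_diff_cancel diff_le_self)
      from this [of "\<lambda>i k. coeff q i = (-1) ^ k * p k"] show ?thesis .
    qed
    also have "\<dots> \<longleftrightarrow> (\<forall>k\<le>m. p k = (-1) ^ k * coeff q (m - k))"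
    proof -
      have "coeff q (m - k) = (-1) ^ k * p k \<longleftrightarrow> p k = (-1) ^ k * coeff q (m - k)" for k
        by (cases "even k") auto
      then show ?thesis by simp
    qed
    finally show ?thesis
      unfolding is_stirling_coeffs_def by (auto simp: fun_eq_iff not_le)
  qed
  then show *: "\<exists>!p. is_stirling_coeffs m x p"
    by simp
  show "is_stirling_coeffs m x (\<lambda>k. stirling_poly k m x)"
    unfolding stirling_poly_def using theI' [OF *] by simp
qed

text \<open>
  The analytic continuation of the Hurwitz series in \<open>s\<close>, for fixed \<open>z\<close>, to the complex plane without
  the point \<open>1\<close>. The value \<open>0\<close> at the pole only makes the continuation unique as a total function.
\<close>

definition is_hurwitz_zeta :: "complex \<Rightarrow> (complex \<Rightarrow> complex) \<Rightarrow> bool" where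
  "is_hurwitz_zeta z f \<longleftrightarrow>
     f holomorphic_on (- {1}) \<and>
     (\<forall>s. Re s > 1 \<longrightarrow> (\<lambda>n. (of_nat n + z) powr (- s)) sums f s) \<and>
     f 1 = 0"

definition hurwitz_zeta :: "complex \<Rightarrow> complex \<Rightarrow> complex" where
  "hurwitz_zeta s z = (THE f. is_hurwitz_zeta z f) s"

lemma is_hurwitz_zeta_unique:
  assumes f: "is_hurwitz_zeta z f" and g: "is_hurwitz_zeta z g"
  shows "f = g"
proof
  fix s
  show "f s = g s"
  proof (cases "s = 1")
    case True
    then show ?thesis using f g by (simp add: is_hurwitz_zeta_def)
  next
    case False
    have eq: "f w = g w" if "w \<in> {w. Re w > 1}" for w
      using f g that by (auto simp: is_hurwitz_zeta_def intro: sums_unique2)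
    show ?thesis
    proof (rule analytic_continuation_open [of "{w. Re w > 1}" "- {1}" f g])
      show "{w. Re w > 1} \<noteq> {}"
        by (auto intro: exI [of _ 2])
      show "connected (- {1::complex})"
        by (rule connected_punctured_universe) simp
      show "{w. Re w > 1} \<subseteq> - {1}"
        by auto
    qed (use f g eq False in \<open>simp_all add: is_hurwitz_zeta_def open_halfspace_Re_gt open_Compl\<close>)
  qed
qed

text \<open>
  The difference \<open>\<zeta>(s,x) - \<zeta>(s,y)\<close>, read as a limit at \<open>s = 1\<close>, where the poles cancel.
\<close>

definition hurwitz_zeta_diff :: "complex \<Rightarrow> complex \<Rightarrow> complex \<Rightarrow> complex" where
  "hurwitz_zeta_diff s x y =
     (if s = 1 then Lim (at 1) (\<lambda>t. hurwitz_zeta t x - hurwitz_zeta t y)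
      else hurwitz_zeta s x - hurwitz_zeta s y)"

end

theory Submission
  imports Defs
begin

text \<open>
  For fixed \<open>x\<close> the difference \<open>D(s) = \<zeta>(s, x) - \<zeta>(s, x + 1/2)\<close> is the alternating series
  \<open>2\<^sup>s (\<Sum>j. (-1)\<^sup>j (j + 2x)\<^sup>-\<^sup>s)\<close>, continued in \<open>s\<close>. With \<open>x = n/4\<close>, the
  definition of the polynomials \<open>P\<^sub>k\<close> therefore turns the two sums of the theorem, up to
  powers of \<open>2\<close>, into regularised values of the divergent series
  \<open>\<Sum>j. (-1)\<^sup>j (j+1)\<^sub>n\<^sub>-\<^sub>1 / (j + n/2)\<close> and \<open>\<Sum>j. (-1)\<^sup>j (j+1)\<^sub>n\<^sub>+\<^sub>1 / (j + n/2 + 1)\<close>.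
  Shifting \<open>j\<close> by one in the second series makes the denominators agree, and since
  \<open>j (j + n) = (j + n/2)\<^sup>2 - n\<^sup>2/4\<close>, the multiple \<open>n\<^sup>2/4\<close> of the first series cancels. What
  remains is a regularised sum \<open>\<Sum>j. (-1)\<^sup>j f(j)\<close> of the polynomial
  \<open>f(j) = (j+1)\<^sub>n\<^sub>-\<^sub>1 (j + n/2)\<close>.

  Regularisation assigns to such a sum the value \<open>g(0)\<close>, where \<open>g\<close> is the polynomial with
  \<open>g(t) + g(t+1) = f(t)\<close>. It is unique, so the symmetry \<open>f(-n-t) = (-1)\<^sup>n f(t)\<close> forces
  \<open>g(1-n-t) = (-1)\<^sup>n g(t)\<close>. On the other hand \<open>f\<close> vanishes at \<open>-1, \<dots>, -(n-1)\<close>, which gives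
  \<open>g(1-n) = (-1)\<^sup>n\<^sup>-\<^sup>1 g(0)\<close>. Hence \<open>g(0) = 0\<close>; this is \<open>alternating_sum_pochhammer_eq_0\<close>.

  The analysis has to supply three facts about the Hurwitz zeta function at real \<open>a > 0\<close>:
  it has a continuation to the plane without \<open>1\<close>; the shift \<open>\<zeta>(s, a) - \<zeta>(s, a+1) = a\<^sup>-\<^sup>s\<close>
  persists, for \<open>s = 1\<close> as a limit (\<open>hurwitz_zeta_diff_shift\<close>); and \<open>\<zeta>(-m, a)\<close> is a polynomial
  in \<open>a\<close> (\<open>hurwitz_zeta_neg_of_nat\<close>). The last fact is what makes \<open>g\<close> a polynomial: the shift
  equation alone determines \<open>g\<close> only up to functions with \<open>h(t) + h(t+1) = 0\<close>. All three come
  from one recursion for \<open>Z(s) = (s-1) \<zeta>(s, a)\<close>: summing the Taylor expansion of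
  \<open>y \<mapsto> y\<^sup>1\<^sup>-\<^sup>s\<close> over the unit steps from \<open>y = a + j\<close> expresses \<open>Z(s)\<close> through
  \<open>Z(s+1), Z(s+2), \<dots>\<close> and a remainder series that converges further to the left.
\<close>

section \<open>Series of holomorphic functions on a half-plane\<close>

text \<open>
  The terms \<open>(n + a) powr (c - 1 - Re s)\<close> are summable exactly for \<open>Re s > c\<close>, and locally uniformly
  so, because a small disc around \<open>s\<close> keeps a positive distance from the line \<open>Re s = c\<close>.
\<close>

lemma holomorphic_suminf_half_plane:
  fixes f :: "nat \<Rightarrow> complex \<Rightarrow> complex" and K :: "complex \<Rightarrow> real" and a c :: real
  assumes a: "a > 0"
    and hol: "\<And>n. f n holomorphic_on {s. Re s > c}"
    and K: "continuous_on {s. Re s > c} K"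
    and bound: "\<And>n s. Re s > c \<Longrightarrow> norm (f n s) \<le> K s * (real n + a) powr (c - 1 - Re s)"
  shows "(\<lambda>s. \<Sum>n. f n s) holomorphic_on {s. Re s > c}"
    and "Re s > c \<Longrightarrow> summable (\<lambda>n. f n s)"
proof -
  have loc: "\<exists>d>0. cball s d \<subseteq> {s. Re s > c} \<and>
      uniform_limit (cball s d) (\<lambda>N s. \<Sum>n<N. f n s) (\<lambda>s. \<Sum>n. f n s) sequentially \<and>
      summable (\<lambda>n. f n s)"
    if s: "s \<in> {s. Re s > c}" for s
  proof -
    \<comment> \<open>Half the distance of \<open>s\<close> to the line, so that the exponent stays below \<open>- 1 - d\<close> on the disc.\<close>
    define d where "d = (Re s - c) / 2"
    have d: "d > 0"
      using s by (simp add: d_def)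
    have far: "Re t \<ge> c + d" if "t \<in> cball s d" for t
    proof -
      have "Re s - Re t \<le> d"
        using that abs_Re_le_cmod [of "s - t"] by (simp add: dist_norm)
      then show ?thesis
        by (simp add: d_def field_simps)
    qed
    have sub: "cball s d \<subseteq> {s. Re s > c}"
      using far d by (force simp del: mem_cball)
    have "bounded (K ` cball s d)"
      by (intro compact_imp_bounded compact_continuous_image continuous_on_subset [OF K sub] compact_cball)
    then obtain B where B0: "B > 0" and "\<forall>t\<in>cball s d. \<bar>K t\<bar> \<le> B"
      unfolding bounded_pos by auto
    then have B: "K t \<le> B" if "t \<in> cball s d" for t
      using that by (meson abs_le_D1)
    have le: "norm (f n t) \<le> B * real n powr (- 1 - d)" if t: "t \<in> cball s d" and n: "n \<ge> 1" for n t
    proof -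
      have "(real n + a) powr (c - 1 - Re t) \<le> real n powr (c - 1 - Re t)"
        using far [OF t] d a n by (intro powr_mono2') auto
      also have "\<dots> \<le> real n powr (- 1 - d)"
        using far [OF t] n by (intro powr_mono) auto
      finally have "K t * (real n + a) powr (c - 1 - Re t) \<le> B * real n powr (- 1 - d)"
        using B [OF t] B0 by (intro mult_mono) auto
      moreover have "Re t > c"
        using far [OF t] d by simp
      ultimately show ?thesis
        using order_trans [OF bound [of t n]] by blast
    qed
    have sm: "summable (\<lambda>n. B * real n powr (- 1 - d))"
      using d by (intro summable_mult) (simp add: summable_real_powr_iff)
    have "uniform_limit (cball s d) (\<lambda>N s. \<Sum>n<N. f n s) (\<lambda>s. \<Sum>n. f n s) sequentially"
      by (rule Weierstrass_m_test_ev [OF _ sm])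
         (auto intro!: eventually_sequentiallyI [of 1] le)
    moreover have "summable (\<lambda>n. f n s)"
      by (rule summable_comparison_test_ev [OF _ sm])
         (use d in \<open>auto intro!: eventually_sequentiallyI [of 1] le\<close>)
    ultimately show ?thesis
      using d sub by (intro exI [of _ d] conjI)
  qed
  show "(\<lambda>s. \<Sum>n. f n s) holomorphic_on {s. Re s > c}"
  proof (rule holomorphic_uniform_sequence [where f = "\<lambda>N s. \<Sum>n<N. f n s"])
    show "open {s. Re s > c}"
      by (rule open_halfspace_Re_gt)
    show "(\<lambda>s. \<Sum>n<N. f n s) holomorphic_on {s. Re s > c}" for N
      by (intro holomorphic_intros hol)
  qed (use loc in blast)
  show "summable (\<lambda>n. f n s)" if "Re s > c"
    using loc [of s] that by blast
qed

section \<open>Taylor expansion of a power over a unit step\<close>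

definition powr_taylor_remainder :: "nat \<Rightarrow> complex \<Rightarrow> complex \<Rightarrow> complex" where
  "powr_taylor_remainder M s x = (x + 1) powr (1 - s) -
     (\<Sum>i\<le>M. (-1) ^ i * pochhammer (s - 1) i / fact i * x powr (1 - s - of_nat i))"

lemma norm_powr_taylor_remainder_le:
  fixes x :: real
  assumes x: "x > 0" and s: "Re s \<ge> - real M"
  shows "norm (powr_taylor_remainder M s (of_real x))
    \<le> norm (pochhammer (s - 1) (Suc M)) * x powr (- Re s - real M)"
proof -
  define f where "f i z = (-1) ^ i * pochhammer (s - 1) i * z powr (1 - s - of_nat i)" for i and z :: complex
  define B where "B = norm (pochhammer (s - 1) (Suc M)) * x powr (- Re s - real M)"
  define S where "S = complex_of_real ` {x..x+1}"
  have "norm (f 0 (of_real (x + 1)) - (\<Sum>i\<le>M. f i (of_real x) * (of_real (x + 1) - of_real x) ^ i / fact i))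
    \<le> B * norm (of_real (x + 1) - complex_of_real x) ^ Suc M / fact M"
  proof (rule complex_Taylor)
    show "convex S"
      unfolding S_def by (intro convex_linear_image) (auto intro: bounded_linear.linear bounded_linear_of_real)
    fix z assume "z \<in> S"
    then obtain t where t: "z = of_real t" "t \<ge> x"
      by (auto simp: S_def)
    then have z: "z \<notin> \<real>\<^sub>\<le>\<^sub>0"
      using x by simp
    show "(f i has_field_derivative f (Suc i) z) (at z within S)" for i
    proof -
      have "(f i has_field_derivative
          (-1) ^ i * pochhammer (s - 1) i * ((1 - s - of_nat i) * z powr (1 - s - of_nat i - 1))) (at z within S)"
        unfolding f_def
        by (rule has_field_derivative_at_within, rule DERIV_cmult, rule has_field_derivative_powr [OF z])
      also have "(-1) ^ i * pochhammer (s - 1) i * ((1 - s - of_nat i) * z powr (1 - s - of_nat i - 1)) = f (Suc i) z"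
        by (simp add: f_def pochhammer_Suc algebra_simps)
      finally show ?thesis .
    qed
    have "norm (f (Suc M) z) = norm (pochhammer (s - 1) (Suc M)) * t powr (- Re s - real M)"
      using t x by (simp add: f_def norm_mult norm_power norm_powr_real_powr)
    also have "\<dots> \<le> B"
      unfolding B_def using t x s by (intro mult_left_mono powr_mono2') auto
    finally show "norm (f (Suc M) z) \<le> B" .
  qed (auto simp: S_def simp del: of_real_add)
  also have "\<dots> \<le> B"
  proof -
    have "B * 1 / fact M \<le> B * 1 / 1"
      by (intro divide_left_mono) (auto simp: B_def fact_ge_1)
    then show ?thesis by simp
  qed
  finally show ?thesis
    by (simp add: f_def B_def powr_taylor_remainder_def mult_ac)
qed

text \<open>
  The Taylor expansion solved for the leading term \<open>(s-1) x\<^sup>-\<^sup>s\<close>, the general term of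
  \<open>(s-1) \<zeta>(s, a)\<close>. The left-hand side telescopes when \<open>x\<close> runs through \<open>a + n\<close>.
\<close>

lemma powr_taylor_remainder_rec:
  "x powr (1 - s) - (x + 1) powr (1 - s) =
     (s - 1) * x powr (- s)
     - (\<Sum>i=2..Suc M. (-1) ^ i * pochhammer (s - 1) i / fact i * x powr (1 - s - of_nat i))
     - powr_taylor_remainder (Suc M) s x"
proof -
  have "{..Suc M} = insert 0 (insert 1 {2..Suc M})"
    by auto
  then show ?thesis
    unfolding powr_taylor_remainder_def by (simp add: algebra_simps)
qed

section \<open>Analytic continuation of the Hurwitz zeta function\<close>

lemma holomorphic_powr_taylor_remainder:
  assumes "x \<noteq> 0" "x + 1 \<noteq> 0"
  shows "(\<lambda>s. powr_taylor_remainder M s x) holomorphic_on A"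
  unfolding powr_taylor_remainder_def using assms by (auto intro!: holomorphic_intros)

lemma of_nat_add_of_real_neq_0:
  assumes "(a::real) > 0"
  shows "of_nat n + complex_of_real a \<noteq> 0" "of_nat n + complex_of_real a + 1 \<noteq> 0"
proof -
  have "of_nat n + complex_of_real a = of_real (real n + a)"
    and "of_nat n + complex_of_real a + 1 = of_real (real n + a + 1)"
    by simp_all
  moreover have "real n + a \<noteq> 0" "real n + a + 1 \<noteq> 0"
    using assms by linarith+
  ultimately show "of_nat n + complex_of_real a \<noteq> 0" "of_nat n + complex_of_real a + 1 \<noteq> 0"
    by (metis of_real_eq_0_iff)+
qed

lemma norm_of_nat_add_of_real_powr:
  assumes "(a::real) > 0"
  shows "norm ((of_nat n + complex_of_real a) powr s) = (real n + a) powr Re s"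
proof -
  have "norm (complex_of_real (real n + a) powr s) = (real n + a) powr Re s"
    using assms by (subst norm_powr_real_powr) auto
  then show ?thesis by simp
qed

lemma hurwitz_series:
  assumes a: "(a::real) > 0"
  shows "(\<lambda>s. \<Sum>n. (of_nat n + of_real a) powr (- s)) holomorphic_on {s. Re s > 1}"
    and "Re s > 1 \<Longrightarrow> summable (\<lambda>n. (of_nat n + complex_of_real a) powr (- s))"
proof -
  have *: "(\<lambda>s. (of_nat n + complex_of_real a) powr (- s)) holomorphic_on {s. Re s > 1}" for n
    using of_nat_add_of_real_neq_0 [OF a] by (auto intro!: holomorphic_intros)
  note lim = holomorphic_suminf_half_plane [of a "\<lambda>n s. (of_nat n + complex_of_real a) powr (- s)" 1 "\<lambda>_. 1"]
  show "(\<lambda>s. \<Sum>n. (of_nat n + of_real a) powr (- s)) holomorphic_on {s. Re s > 1}"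
    by (rule lim) (use a * in \<open>auto simp: norm_of_nat_add_of_real_powr\<close>)
  show "summable (\<lambda>n. (of_nat n + complex_of_real a) powr (- s))" if "Re s > 1"
    by (rule lim) (use that a * in \<open>auto simp: norm_of_nat_add_of_real_powr\<close>)
qed

lemma powr_taylor_remainder_series:
  assumes a: "(a::real) > 0"
  shows "(\<lambda>s. \<Sum>n. powr_taylor_remainder (Suc M) s (of_nat n + of_real a)) holomorphic_on {s. Re s > - real M}"
    and "Re s > - real M \<Longrightarrow> summable (\<lambda>n. powr_taylor_remainder (Suc M) s (of_nat n + of_real a))"
proof -
  define K where "K s = norm (pochhammer (s - 1) (Suc (Suc M)))" for s :: complex
  have K: "continuous_on A K" for A
    unfolding K_def by (intro continuous_intros)
  have bound: "norm (powr_taylor_remainder (Suc M) s (of_nat n + of_real a))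
      \<le> K s * (real n + a) powr (- real M - 1 - Re s)" if "Re s > - real M" for n s
  proof -
    have "norm (powr_taylor_remainder (Suc M) s (of_nat n + of_real a))
        \<le> K s * (real n + a) powr (- Re s - real (Suc M))"
      using norm_powr_taylor_remainder_le [of "real n + a" "Suc M" s] that a by (simp add: K_def)
    also have "- Re s - real (Suc M) = - real M - 1 - Re s"
      by simp
    finally show ?thesis .
  qed
  note lim = holomorphic_suminf_half_plane
    [OF a holomorphic_powr_taylor_remainder [OF of_nat_add_of_real_neq_0 [OF a]] K bound]
  show "(\<lambda>s. \<Sum>n. powr_taylor_remainder (Suc M) s (of_nat n + of_real a)) holomorphic_on {s. Re s > - real M}"
    by (rule lim(1)) auto
  show "summable (\<lambda>n. powr_taylor_remainder (Suc M) s (of_nat n + of_real a))" if "Re s > - real M"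
    by (rule lim(2)) (use that in auto)
qed

text \<open>
  \<open>zeta_numer N a\<close> is \<open>(s-1) \<zeta>(s, a)\<close> on the half-plane \<open>Re s > 1 - N\<close>. The factor \<open>s-1\<close>
  removes the pole, and with it the terms of the recursion stay regular: in the Taylor coefficient
  \<open>(s-1)\<^sub>i\<close> of \<open>\<zeta>(s+i-1, a)\<close> the last factor \<open>s+i-2\<close> is absorbed into \<open>zeta_numer\<close> at
  \<open>s+i-1\<close>, which leaves \<open>(s-1)\<^sub>i\<^sub>-\<^sub>1\<close>.
\<close>

fun zeta_numer :: "nat \<Rightarrow> real \<Rightarrow> complex \<Rightarrow> complex" where
  "zeta_numer 0 a s = (s - 1) * (\<Sum>n. (of_nat n + of_real a) powr (- s))"
| "zeta_numer (Suc N) a s =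
     of_real a powr (1 - s)
     + (\<Sum>i=2..Suc N. (-1) ^ i / fact i * pochhammer (s - 1) (i - 1) * zeta_numer N a (s + of_nat i - 1))
     + (\<Sum>n. powr_taylor_remainder (Suc N) s (of_nat n + of_real a))"

lemma holomorphic_zeta_numer:
  assumes a: "a > 0"
  shows "zeta_numer N a holomorphic_on {s. Re s > 1 - real N}"
proof (induction N)
  case 0
  then show ?case
    using hurwitz_series(1) [OF a] by (auto intro!: holomorphic_intros)
next
  case (Suc N)
  have comp: "(\<lambda>s. zeta_numer N a (s + of_nat i - 1)) holomorphic_on {s. Re s > - real N}" if "i \<ge> 2" for i
    by (rule holomorphic_on_compose_gen [OF _ Suc.IH, unfolded o_def])
       (use that in \<open>auto intro!: holomorphic_intros\<close>)
  have "(\<lambda>s. zeta_numer (Suc N) a s) holomorphic_on {s. Re s > - real N}"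
    unfolding zeta_numer.simps using a
    by (intro holomorphic_intros comp powr_taylor_remainder_series) auto
  then show ?case
    by simp
qed

text \<open>
  Where the Hurwitz series converges, all stages of the recursion agree, because there each later one
  is the termwise sum of \<open>powr_taylor_remainder_rec\<close> over \<open>x = a + n\<close>.
\<close>

lemma zeta_numer_eq_series:
  assumes a: "a > 0" and s: "Re s > 1"
  shows "zeta_numer N a s = zeta_numer 0 a s"
  using s
proof (induction N arbitrary: s)
  case (Suc N)
  define x where "x n = of_nat n + complex_of_real a" for n
  have x_Suc: "x n + 1 = x (Suc n)" for n
    by (simp add: x_def algebra_simps)
  have sm: "(\<lambda>n. x n powr (- t)) sums (\<Sum>n. x n powr (- t))" if "Re t > 1" for t
    using hurwitz_series(2) [OF a that] unfolding x_def by (rule summable_sums)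
  have "(\<lambda>n. x n powr (1 - s)) \<longlonglongrightarrow> 0"
  proof (rule tendsto_norm_zero_cancel)
    have "(\<lambda>n. (real n + a) powr (1 - Re s)) \<longlonglongrightarrow> 0"
      by (rule tendsto_neg_powr)
         (use Suc.prems in \<open>auto intro!: filterlim_tendsto_add_at_top [OF tendsto_const] filterlim_real_sequentially
             simp: add.commute [of _ a]\<close>)
    then show "(\<lambda>n. norm (x n powr (1 - s))) \<longlonglongrightarrow> 0"
      unfolding x_def by (simp add: norm_of_nat_add_of_real_powr [OF a])
  qed
  then have "(\<lambda>n. x n powr (1 - s) - (x n + 1) powr (1 - s)) sums (x 0 powr (1 - s) - 0)"
    unfolding x_Suc by (rule telescope_sums')
  moreover have "(\<lambda>n. x n powr (1 - s) - (x n + 1) powr (1 - s)) sums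
    ((s - 1) * (\<Sum>n. x n powr (- s))
     - (\<Sum>i=2..Suc N. (-1) ^ i * pochhammer (s - 1) i / fact i * (\<Sum>n. x n powr (- (s + of_nat i - 1))))
     - (\<Sum>n. powr_taylor_remainder (Suc N) s (x n)))"
  proof -
    have "(\<lambda>n. \<Sum>i=2..Suc N. (-1) ^ i * pochhammer (s - 1) i / fact i * x n powr (1 - s - of_nat i)) sums
      (\<Sum>i=2..Suc N. (-1) ^ i * pochhammer (s - 1) i / fact i * (\<Sum>n. x n powr (- (s + of_nat i - 1))))"
    proof (intro sums_sum sums_mult)
      fix i assume "i \<in> {2..Suc N}"
      then show "(\<lambda>n. x n powr (1 - s - of_nat i)) sums (\<Sum>n. x n powr (- (s + of_nat i - 1)))"
        using sm [of "s + of_nat i - 1"] Suc.prems by (simp add: algebra_simps)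
    qed
    moreover have "(\<lambda>n. powr_taylor_remainder (Suc N) s (x n)) sums (\<Sum>n. powr_taylor_remainder (Suc N) s (x n))"
      unfolding x_def by (intro summable_sums powr_taylor_remainder_series) (use a Suc.prems in auto)
    ultimately show ?thesis
      unfolding powr_taylor_remainder_rec [of _ s N] by (intro sums_diff sums_mult sm Suc.prems)
  qed
  ultimately have eq: "x 0 powr (1 - s) = (s - 1) * (\<Sum>n. x n powr (- s))
     - (\<Sum>i=2..Suc N. (-1) ^ i * pochhammer (s - 1) i / fact i * (\<Sum>n. x n powr (- (s + of_nat i - 1))))
     - (\<Sum>n. powr_taylor_remainder (Suc N) s (x n))"
    using sums_unique2 by fastforce
  have "(\<Sum>i=2..Suc N. (-1) ^ i / fact i * pochhammer (s - 1) (i - 1) * zeta_numer N a (s + of_nat i - 1))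
    = (\<Sum>i=2..Suc N. (-1) ^ i * pochhammer (s - 1) i / fact i * (\<Sum>n. x n powr (- (s + of_nat i - 1))))"
  proof (rule sum.cong)
    fix i assume i: "i \<in> {2..Suc N}"
    then obtain k where k: "i = Suc k" by (cases i) auto
    have "zeta_numer N a (s + of_nat i - 1) = zeta_numer 0 a (s + of_nat i - 1)"
      using i Suc.prems by (intro Suc.IH) auto
    also have "\<dots> = (s - 1 + of_nat k) * (\<Sum>n. x n powr (- (s + of_nat i - 1)))"
      by (simp add: x_def k)
    finally show "(-1) ^ i / fact i * pochhammer (s - 1) (i - 1) * zeta_numer N a (s + of_nat i - 1)
      = (-1) ^ i * pochhammer (s - 1) i / fact i * (\<Sum>n. x n powr (- (s + of_nat i - 1)))"
      by (simp only: k pochhammer_Suc) (simp add: mult_ac)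
  qed simp
  then show ?case
    using eq by (simp add: x_def del: sum.cl_ivl_Suc)
qed simp

lemma zeta_numer_mono:
  assumes a: "a > 0" and "N \<le> N'" and s: "Re s > 1 - real N"
  shows "zeta_numer N' a s = zeta_numer N a s"
proof (rule analytic_continuation_open [of "{s. Re s > 1}" "{s. Re s > 1 - real N}" "zeta_numer N' a" "zeta_numer N a"])
  show "zeta_numer N' a holomorphic_on {s. Re s > 1 - real N}"
    by (rule holomorphic_on_subset [OF holomorphic_zeta_numer [OF a, of N']]) (use assms in auto)
  show "zeta_numer N' a t = zeta_numer N a t" if "t \<in> {s. Re s > 1}" for t
    using zeta_numer_eq_series [OF a, of t] that by simp
  show "{s. Re s > 1} \<noteq> {}"
    by (auto intro: exI [of _ 2])
qed (use s holomorphic_zeta_numer [OF a] in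
      \<open>auto simp: open_halfspace_Re_gt intro: convex_connected convex_halfspace_Re_gt\<close>)

lemma powr_taylor_remainder_eq_0:
  assumes "x > 0" "Re s \<ge> - real M" "pochhammer (s - 1) (Suc M) = 0"
  shows "powr_taylor_remainder M s (of_real x) = 0"
  using norm_powr_taylor_remainder_le [OF assms(1,2)] assms(3) by simp

text \<open>
  At \<open>s = 1\<close> every term of the recursion but \<open>a\<^sup>0\<close> carries a factor \<open>(0)\<^sub>i = 0\<close>. So the pole of
  \<open>\<zeta>(s, a)\<close> at \<open>1\<close> has a residue independent of \<open>a\<close>, and the poles cancel in differences.
\<close>

lemma zeta_numer_1:
  assumes a: "a > 0"
  shows "zeta_numer (Suc N) a 1 = 1"
proof -
  have "powr_taylor_remainder (Suc N) 1 (of_nat n + of_real a) = 0" for n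
    using powr_taylor_remainder_eq_0 [of "real n + a" "Suc N" 1] a by (simp add: pochhammer_0_left)
  moreover have "(\<Sum>i=2..Suc N. (-1) ^ i / fact i * pochhammer 0 (i - 1) * zeta_numer N a (of_nat i)) = 0"
    by (intro sum.neutral) (auto simp: pochhammer_0_left)
  ultimately show ?thesis
    using a by (simp del: sum.cl_ivl_Suc)
qed

text \<open>
  At \<open>s = -m\<close> the rising factorials \<open>(-m-1)\<^sub>i\<close> with \<open>i \<ge> m + 2\<close> vanish. This kills the remainder
  series, and the finitely many terms left are \<open>a\<^sup>m\<^sup>+\<^sup>1\<close>, multiples of the values at
  \<open>-(m-1), \<dots>, 0\<close>, and a multiple of the value at \<open>1\<close>.
\<close>

lemma zeta_numer_neg_of_nat:
  assumes "m + 2 \<le> N"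
  shows "\<exists>p. \<forall>a>0. zeta_numer N a (- of_nat m) = poly p (of_real a)"
  using assms
proof (induction m arbitrary: N rule: less_induct)
  case (less m)
  then obtain N' where N: "N = Suc N'" "N' \<ge> Suc m"
    by (cases N) auto
  let ?c = "\<lambda>i. (-1) ^ i / fact i * pochhammer (- of_nat m - 1) (i - 1) :: complex"
  have "\<exists>p. \<forall>a>0. ?c i * zeta_numer N' a (- of_nat m + of_nat i - 1) = poly p (of_real a)"
    if i: "i \<in> {2..Suc N'}" for i
  proof -
    consider "i - 1 \<le> m" | "i = m + 2" | "i - 1 \<ge> m + 2"
      by linarith
    then show ?thesis
    proof cases
      case 1
      then have "- of_nat m + of_nat i - 1 = - complex_of_nat (m - (i - 1))"
        using i by (simp add: of_nat_diff)
      moreover obtain p where "\<forall>a>0. zeta_numer N' a (- of_nat (m - (i - 1))) = poly p (of_real a)"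
      proof -
        have "m - (i - 1) < m" "m - (i - 1) + 2 \<le> N'"
          using i 1 N by auto
        from less.IH [OF this] show ?thesis
          using that by blast
      qed
      ultimately show ?thesis
        by (intro exI [of _ "smult (?c i) p"]) simp
    next
      case 2
      obtain k where "N' = Suc k" using N by (cases N') auto
      then have "zeta_numer N' a (- of_nat m + of_nat i - 1) = 1" if "a > 0" for a
        using zeta_numer_1 [OF that] 2 by simp
      then show ?thesis
        by (intro exI [of _ "[:?c i:]"]) simp
    next
      case 3
      have "pochhammer (- of_nat (Suc m)) (i - 1) = (0 :: complex)"
        using 3 by (simp add: pochhammer_of_nat_eq_0_iff del: of_nat_Suc)
      also have "- of_nat (Suc m) = - of_nat m - (1 :: complex)"
        by simp
      finally have "?c i = 0"
        by simp
      then show ?thesis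
        by (intro exI [of _ 0]) simp
    qed
  qed
  then obtain p where p: "\<And>i a. i \<in> {2..Suc N'} \<Longrightarrow> a > 0 \<Longrightarrow>
      ?c i * zeta_numer N' a (- of_nat m + of_nat i - 1) = poly (p i) (of_real a)"
    by metis
  have rem: "powr_taylor_remainder (Suc N') (- of_nat m) (of_nat n + of_real a) = 0" if "a > 0" for n a
  proof -
    have "pochhammer (- of_nat (Suc m)) (Suc (Suc N')) = (0 :: complex)"
      using N by (simp add: pochhammer_of_nat_eq_0_iff del: of_nat_Suc)
    also have "- of_nat (Suc m) = - of_nat m - (1 :: complex)"
      by simp
    finally show ?thesis
      using powr_taylor_remainder_eq_0 [of "real n + a" "Suc N'" "- of_nat m"] that N by simp
  qed
  have "zeta_numer N a (- of_nat m) = poly (monom 1 (Suc m) + (\<Sum>i=2..Suc N'. p i)) (of_real a)"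
    if a: "a > 0" for a
  proof -
    have "complex_of_real a powr (1 + of_nat m) = of_real a ^ Suc m"
      using a powr_nat' [of "of_real a" "Suc m"] by simp
    then show ?thesis
      using a p rem by (simp add: N poly_sum poly_monom del: power_Suc sum.cl_ivl_Suc)
  qed
  then show ?case by blast
qed

text \<open>
  The entire function \<open>(s-1) \<zeta>(s, a)\<close>: the index is large enough for \<open>s\<close> to lie in the half-plane
  of that stage.
\<close>

definition hurwitz_numer :: "real \<Rightarrow> complex \<Rightarrow> complex" where
  "hurwitz_numer a s = zeta_numer (nat \<lceil>2 - Re s\<rceil>) a s"

lemma hurwitz_numer_eq:
  assumes a: "a > 0" and s: "Re s > 1 - real N"
  shows "hurwitz_numer a s = zeta_numer N a s"
proof -
  define K where "K = nat \<lceil>2 - Re s\<rceil>"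
  have K: "Re s > 1 - real K"
    unfolding K_def by linarith
  show ?thesis
    using zeta_numer_mono [OF a _ K, of N] zeta_numer_mono [OF a _ s, of K]
    unfolding hurwitz_numer_def K_def [symmetric] by (metis nat_le_linear)
qed

lemma holomorphic_hurwitz_numer:
  assumes a: "a > 0"
  shows "hurwitz_numer a holomorphic_on A"
proof -
  have "hurwitz_numer a holomorphic_on (\<Union>N. {s. Re s > 1 - real N})"
  proof (rule holomorphic_on_UN_open)
    show "hurwitz_numer a holomorphic_on {s. Re s > 1 - real N}" for N
      using holomorphic_zeta_numer [OF a, of N] hurwitz_numer_eq [OF a, of N]
      by (auto intro: holomorphic_transform)
  qed (rule open_halfspace_Re_gt)
  moreover have "\<exists>N. Re s > 1 - real N" for s
    using reals_Archimedean2 [of "1 - Re s"] by (auto simp: algebra_simps)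
  then have "(\<Union>N. {s. Re s > 1 - real N}) = UNIV"
    by blast
  ultimately have "hurwitz_numer a holomorphic_on UNIV"
    by simp
  then show ?thesis
    by (rule holomorphic_on_subset) simp
qed

lemma hurwitz_numer_1: "a > 0 \<Longrightarrow> hurwitz_numer a 1 = 1"
  using zeta_numer_1 [of a 0] by (simp add: hurwitz_numer_def del: zeta_numer.simps)

lemma is_hurwitz_zeta_of_real:
  assumes a: "a > 0"
  shows "is_hurwitz_zeta (of_real a) (\<lambda>s. if s = 1 then 0 else hurwitz_numer a s / (s - 1))"
proof -
  have "(\<lambda>s. hurwitz_numer a s / (s - 1)) holomorphic_on - {1}"
    using holomorphic_hurwitz_numer [OF a] by (auto intro!: holomorphic_intros)
  then have "(\<lambda>s. if s = 1 then 0 else hurwitz_numer a s / (s - 1)) holomorphic_on - {1}"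
    by (rule holomorphic_transform) auto
  moreover have "(\<lambda>n. (of_nat n + of_real a) powr (- s)) sums (if s = 1 then 0 else hurwitz_numer a s / (s - 1))"
    if s: "Re s > 1" for s
  proof -
    have "hurwitz_numer a s = (s - 1) * (\<Sum>n. (of_nat n + of_real a) powr (- s))"
      using hurwitz_numer_eq [OF a, of 0 s] s by simp
    moreover have "s \<noteq> 1"
      using s by auto
    ultimately show ?thesis
      using summable_sums [OF hurwitz_series(2) [OF a s]] by simp
  qed
  ultimately show ?thesis
    by (simp add: is_hurwitz_zeta_def)
qed

lemma hurwitz_zeta_of_real:
  assumes "a > 0" "s \<noteq> 1"
  shows "hurwitz_zeta s (of_real a) = hurwitz_numer a s / (s - 1)"
proof -
  note ex = is_hurwitz_zeta_of_real [OF assms(1)]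
  have "(THE f. is_hurwitz_zeta (of_real a) f) = (\<lambda>s. if s = 1 then 0 else hurwitz_numer a s / (s - 1))"
    by (rule the_equality [where P = "is_hurwitz_zeta (of_real a)", OF ex is_hurwitz_zeta_unique [OF _ ex]])
  then show ?thesis
    using assms(2) by (simp add: hurwitz_zeta_def)
qed

section \<open>Shifts, special values and differences of the Hurwitz zeta function\<close>

lemma neg_of_nat_neq_1: "- of_nat m \<noteq> (1 :: complex)"
proof -
  have "Re (- of_nat m) \<noteq> Re 1"
    by simp
  then show ?thesis by metis
qed

text \<open>
  These polynomials are the Bernoulli polynomials \<open>B\<^sub>m\<^sub>+\<^sub>1\<close>, divided by \<open>- (m + 1)\<close>.
\<close>

lemma hurwitz_zeta_neg_of_nat:
  "\<exists>p. \<forall>a>0. hurwitz_zeta (- of_nat m) (of_real a) = poly p (of_real a)"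
proof -
  obtain p where p: "\<forall>a>0. zeta_numer (m + 2) a (- of_nat m) = poly p (of_real a)"
    using zeta_numer_neg_of_nat [of m "m + 2"] by auto
  have "hurwitz_zeta (- of_nat m) (of_real a) = poly (smult (1 / (- of_nat m - 1)) p) (of_real a)" if "a > 0" for a
    using p that hurwitz_zeta_of_real [OF that neg_of_nat_neq_1] hurwitz_numer_eq [OF that, of "m + 2" "- of_nat m"] by simp
  then show ?thesis by blast
qed

lemma hurwitz_zeta_shift:
  assumes a: "a > 0" and s: "s \<noteq> 1"
  shows "hurwitz_zeta s (of_real a) - hurwitz_zeta s (of_real (a + 1)) = of_real a powr (- s)"
proof -
  let ?Z = "\<lambda>s. hurwitz_numer a s - hurwitz_numer (a + 1) s"
  have "?Z s = (s - 1) * of_real a powr (- s)"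
  proof (rule analytic_continuation_open [of "{s. Re s > 1}" UNIV ?Z "\<lambda>s. (s - 1) * of_real a powr (- s)"])
    fix t assume "t \<in> {s. Re s > 1}"
    then have t: "Re t > 1" by simp
    have "(\<lambda>n. (of_nat (Suc n) + of_real a) powr (- t)) sums (\<Sum>n. (of_nat n + of_real (a + 1)) powr (- t))"
      using summable_sums [OF hurwitz_series(2) [of "a + 1" t]] a t by (simp add: algebra_simps)
    then have "(\<lambda>n. (of_nat n + of_real a) powr (- t)) sums
        ((\<Sum>n. (of_nat n + of_real (a + 1)) powr (- t)) + of_real a powr (- t))"
      using sums_Suc [of "\<lambda>n. (of_nat n + complex_of_real a) powr (- t)"] by simp
    then have eq: "(\<Sum>n. (of_nat n + of_real a) powr (- t))
        = (\<Sum>n. (of_nat n + of_real (a + 1)) powr (- t)) + of_real a powr (- t)"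
      by (rule sums_unique [symmetric])
    have "?Z t = (t - 1) * (\<Sum>n. (of_nat n + of_real a) powr (- t))
        - (t - 1) * (\<Sum>n. (of_nat n + of_real (a + 1)) powr (- t))"
      using hurwitz_numer_eq [of a 0 t] hurwitz_numer_eq [of "a + 1" 0 t] a t by simp
    also have "\<dots> = (t - 1) * of_real a powr (- t)"
      unfolding eq by (simp only: ring_distribs) simp
    finally show "?Z t = (t - 1) * of_real a powr (- t)" .
  next
    show "{s. Re s > 1} \<noteq> {}"
      by (auto intro: exI [of _ 2])
  qed (use a in \<open>auto simp: open_halfspace_Re_gt intro!: holomorphic_intros holomorphic_hurwitz_numer\<close>)
  moreover have "hurwitz_zeta s (of_real a) - hurwitz_zeta s (of_real (a + 1)) = ?Z s / (s - 1)"
    using hurwitz_zeta_of_real [of a s] hurwitz_zeta_of_real [of "a + 1" s] a s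
    by (simp add: diff_divide_distrib del: of_real_add)
  ultimately show ?thesis
    using s by simp
qed

text \<open>
  The difference is the difference quotient at \<open>1\<close> of the entire function
  \<open>hurwitz_numer x - hurwitz_numer y\<close>, which vanishes there. So the limit behind
  \<open>hurwitz_zeta_diff\<close> at \<open>s = 1\<close> exists.
\<close>

lemma tendsto_hurwitz_zeta_diff_1:
  assumes x: "x > 0" and y: "y > 0"
  shows "((\<lambda>t. hurwitz_zeta t (of_real x) - hurwitz_zeta t (of_real y)) \<longlongrightarrow>
    hurwitz_zeta_diff 1 (of_real x) (of_real y)) (at 1)"
proof -
  let ?Z = "\<lambda>s. hurwitz_numer x s - hurwitz_numer y s"
  have "?Z holomorphic_on UNIV"
    by (intro holomorphic_intros holomorphic_hurwitz_numer x y)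
  then have "(?Z has_field_derivative deriv ?Z 1) (at 1)"
    by (auto intro: holomorphic_derivI)
  then have "((\<lambda>t. ?Z t / (t - 1)) \<longlongrightarrow> deriv ?Z 1) (at 1)"
    by (simp add: has_field_derivative_iff hurwitz_numer_1 x y)
  moreover have "eventually (\<lambda>t. ?Z t / (t - 1) = hurwitz_zeta t (of_real x) - hurwitz_zeta t (of_real y)) (at 1)"
    by (rule eventually_mono [OF eventually_neq_at_within [of 1]])
       (simp add: hurwitz_zeta_of_real x y diff_divide_distrib)
  ultimately have "((\<lambda>t. hurwitz_zeta t (of_real x) - hurwitz_zeta t (of_real y)) \<longlongrightarrow> deriv ?Z 1) (at 1)"
    using tendsto_cong by force
  then show ?thesis
    using tendsto_Lim [OF trivial_limit_at] by (fastforce simp: hurwitz_zeta_diff_def)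
qed

lemma hurwitz_zeta_diff_shift:
  assumes x: "x > 0" and y: "y > 0"
  shows "hurwitz_zeta_diff s (of_real x) (of_real y) + hurwitz_zeta_diff s (of_real y) (of_real (x + 1))
    = of_real x powr (- s)"
proof (cases "s = 1")
  case True
  have "((\<lambda>t. (hurwitz_zeta t (of_real x) - hurwitz_zeta t (of_real y))
      + (hurwitz_zeta t (of_real y) - hurwitz_zeta t (of_real (x + 1)))) \<longlongrightarrow>
    hurwitz_zeta_diff 1 (of_real x) (of_real y) + hurwitz_zeta_diff 1 (of_real y) (of_real (x + 1))) (at 1)"
    using x y by (intro tendsto_add tendsto_hurwitz_zeta_diff_1) auto
  moreover have "eventually (\<lambda>t. (hurwitz_zeta t (of_real x) - hurwitz_zeta t (of_real y))
      + (hurwitz_zeta t (of_real y) - hurwitz_zeta t (of_real (x + 1))) = of_real x powr (- t)) (at 1)"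
    by (rule eventually_mono [OF eventually_neq_at_within [of 1]])
       (use hurwitz_zeta_shift [OF x] in simp)
  ultimately have "((\<lambda>t. of_real x powr (- t)) \<longlongrightarrow>
    hurwitz_zeta_diff 1 (of_real x) (of_real y) + hurwitz_zeta_diff 1 (of_real y) (of_real (x + 1))) (at 1)"
    using tendsto_cong by force
  moreover have "((\<lambda>t. complex_of_real x powr (- t)) \<longlongrightarrow> of_real x powr (- 1)) (at 1)"
    using x by (intro tendsto_intros) auto
  ultimately show ?thesis
    using tendsto_unique [OF trivial_limit_at] True by blast
next
  case False
  then show ?thesis
    using hurwitz_zeta_shift [OF x False] by (simp add: hurwitz_zeta_diff_def)
qed

section \<open>Polynomial solutions of the alternating difference equation\<close>

lemma poly_eqI_infinite:
  fixes p q :: "complex poly"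
  assumes "infinite {z. poly p z = poly q z}"
  shows "p = q"
proof (rule ccontr)
  assume "p \<noteq> q"
  then have "finite {z. poly (p - q) z = 0}"
    by (intro poly_roots_finite) simp
  with assms show False
    by (simp add: poly_diff)
qed

lemma poly_eqI_positive_real:
  fixes p q :: "complex poly"
  assumes "\<And>x. x > 0 \<Longrightarrow> poly p (of_real x) = poly q (of_real x)"
  shows "p = q"
proof (rule poly_eqI_infinite, rule infinite_super)
  show "complex_of_real ` {0<..} \<subseteq> {z. poly p z = poly q z}"
    using assms by auto
  show "infinite (complex_of_real ` {0<..})"
    by (auto dest!: finite_imageD simp: inj_on_def infinite_Ioi)
qed

text \<open>
  Such a polynomial has period \<open>2\<close>, hence is constant, and the constant is its own negative.
  This is the uniqueness of polynomial solutions of \<open>g(t) + g(t+1) = f(t)\<close>.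
\<close>

lemma poly_alternating_eq_0:
  fixes u :: "complex poly"
  assumes "\<And>z. poly u z + poly u (z + 1) = 0"
  shows "u = 0"
proof -
  have neg: "poly u (z + 1) = - poly u z" for z
    using assms [of z] by (simp add: eq_neg_iff_add_eq_0 add.commute)
  have "poly u (of_nat (2 * k)) = poly u 0" for k
  proof (induction k)
    case (Suc k)
    have "poly u (of_nat (2 * Suc k)) = poly u (of_nat (2 * k) + 1 + 1)"
      by (simp add: algebra_simps)
    with Suc show ?case
      unfolding neg by simp
  qed simp
  then have "range (\<lambda>k. complex_of_nat (2 * k)) \<subseteq> {z. poly u z = poly [:poly u 0:] z}"
    by auto
  moreover have "infinite (range (\<lambda>k. complex_of_nat (2 * k)))"
    by (rule range_inj_infinite) (simp add: inj_on_def)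
  ultimately have u: "u = [:poly u 0:]"
    by (intro poly_eqI_infinite) (rule infinite_super)
  then have "poly u (0 + 1) = poly u 0"
    by (metis poly_pCons poly_0 mult_zero_right add_0_right)
  then have "poly u 0 = 0"
    unfolding neg by simp
  with u show ?thesis by simp
qed

text \<open>
  The polynomial in \<open>x\<close> is \<open>2\<^sup>-\<^sup>m\<^sup>-\<^sup>1 E\<^sub>m(2x)\<close> with the Euler polynomial \<open>E\<^sub>m\<close>. Its difference
  equation follows from the shift of \<open>\<zeta>\<close> at positive reals, and extends from there to all
  arguments, as a reflection \<open>t \<mapsto> -n-t\<close> requires.
\<close>

lemma hurwitz_zeta_diff_neg_of_nat:
  obtains q where "\<And>x. x > 0 \<Longrightarrow>
      hurwitz_zeta_diff (- of_nat m) (of_real x) (of_real (x + 1 / 2)) = poly q (of_real x)"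
    and "\<And>z. poly q z + poly q (z + 1 / 2) = z ^ m"
proof -
  obtain p where p: "\<And>a. a > 0 \<Longrightarrow> hurwitz_zeta (- of_nat m) (of_real a) = poly p (of_real a)"
    using hurwitz_zeta_neg_of_nat [of m] by auto
  define q where "q = p - pcompose p [:1 / 2, 1:]"
  have q: "hurwitz_zeta_diff (- of_nat m) (of_real x) (of_real (x + 1 / 2)) = poly q (of_real x)" if "x > 0" for x
    using p [of x] p [of "x + 1 / 2"] that neg_of_nat_neq_1 [of m]
    by (simp add: hurwitz_zeta_diff_def q_def poly_pcompose add.commute)
  have eq: "q + pcompose q [:1 / 2, 1:] = monom 1 m"
  proof (rule poly_eqI_positive_real)
    fix x :: real assume x: "x > 0"
    have "poly q (of_real x) + poly q (of_real (x + 1 / 2)) = of_real x powr (- (- of_nat m))"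
      using hurwitz_zeta_diff_shift [of x "x + 1 / 2" "- of_nat m"] q [of x] q [of "x + 1 / 2"] x
      by (simp add: add.assoc)
    then show "poly (q + pcompose q [:1 / 2, 1:]) (of_real x) = poly (monom 1 m) (of_real x)"
      using x by (simp add: poly_pcompose poly_monom powr_nat' add.commute)
  qed
  have "poly q z + poly q (z + 1 / 2) = z ^ m" for z
  proof -
    have "poly (q + pcompose q [:1 / 2, 1:]) z = poly (monom 1 m) z"
      by (simp only: eq)
    then show ?thesis
      by (simp add: poly_pcompose poly_monom add.commute)
  qed
  with q that show ?thesis by blast
qed

text \<open>
  The right-hand side, \<open>f(t)\<close>, is symmetric or antisymmetric under \<open>t \<mapsto> -n-t\<close> according to the
  parity of \<open>n\<close>, and uniqueness passes this on to \<open>g(1-n) = (-1)\<^sup>n g(0)\<close>. Walking from \<open>0\<close> to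
  \<open>1-n\<close> through the zeros of \<open>f\<close> changes the sign of \<open>g\<close> only \<open>n-1\<close> times.
\<close>

lemma alternating_sum_pochhammer_eq_0:
  fixes g :: "complex poly" and n :: nat
  assumes n: "n \<ge> 1"
    and g: "\<And>t. poly g t + poly g (t + 1) = c * (pochhammer (t + 1) (n - 1) * (t + of_nat n / 2))"
  shows "poly g 0 = 0"
proof -
  define f where "f t = c * (pochhammer (t + 1) (n - 1) * (t + of_nat n / 2))" for t
  have gf: "poly g t + poly g (t + 1) = f t" for t
    unfolding f_def by (rule g)
  have refl: "f (- of_nat n - t) = (-1) ^ n * f t" for t
  proof -
    define k where "k = n - 1"
    have k: "n = Suc k"
      using n by (simp add: k_def)
    have "pochhammer (- (t + of_nat k)) k = (-1) ^ k * pochhammer (t + 1) k"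
      using pochhammer_minus [of "t + of_nat k" k] by simp
    moreover have "- of_nat n - t + 1 = - (t + of_nat k)"
      by (simp add: k)
    ultimately have 1: "pochhammer (- of_nat n - t + 1) k = (-1) ^ k * pochhammer (t + 1) k"
      by (simp only:)
    have 2: "- of_nat n - t + of_nat n / 2 = - (t + of_nat n / 2)"
      by (simp add: field_simps)
    have 3: "(-1) ^ n = - ((-1) ^ k :: complex)"
      by (simp add: k)
    show ?thesis
      unfolding f_def k_def [symmetric] 1 2 3 by (simp only: mult_minus_left mult_minus_right mult_ac)
  qed
  have "g - smult ((-1) ^ n) (pcompose g [:1 - of_nat n, - 1:]) = 0" (is "?u = 0")
  proof (rule poly_alternating_eq_0)
    fix z
    have "poly g (1 - of_nat n - z) + poly g (1 - of_nat n - (z + 1)) = (-1) ^ n * f z"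
    proof -
      have "1 - of_nat n - (z + 1) = - of_nat n - z" "1 - of_nat n - z = - of_nat n - z + 1"
        by simp_all
      then show ?thesis
        using gf [of "- of_nat n - z"] refl [of z] by (simp only: add.commute)
    qed
    then have "(-1) ^ n * poly g (1 - of_nat n - z) + (-1) ^ n * poly g (1 - of_nat n - (z + 1)) = f z"
      by (simp flip: distrib_left)
    moreover have "poly ?u w = poly g w - (-1) ^ n * poly g (1 - of_nat n - w)" for w
      by (simp add: poly_pcompose)
    ultimately show "poly ?u z + poly ?u (z + 1) = 0"
      using gf [of z] by (simp only: add_diff_add [symmetric]) simp
  qed
  then have "poly ?u 0 = 0"
    by simp
  then have "poly g 0 = (-1) ^ n * poly g (1 - of_nat n)"
    by (simp add: poly_pcompose)
  moreover have "poly g (- of_nat k) = (-1) ^ k * poly g 0" if "k \<le> n - 1" for k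
    using that
  proof (induction k)
    case (Suc k)
    have "pochhammer (- of_nat k) (n - 1) = (0 :: complex)"
      using Suc.prems by (simp add: pochhammer_of_nat_eq_0_iff)
    then have "poly g (- of_nat (Suc k)) = - poly g (- of_nat k)"
      using g [of "- of_nat (Suc k)"] by (simp add: eq_neg_iff_add_eq_0)
    with Suc show ?case by simp
  qed simp
  moreover have "1 - of_nat n = - complex_of_nat (n - 1)"
    using n by (simp add: of_nat_diff)
  moreover have "(-1) ^ n * (-1) ^ (n - 1) = (- 1 :: complex)"
    using n by (cases n) auto
  ultimately have "poly g 0 = - poly g 0"
    by (metis le_refl mult.assoc mult_minus1)
  then show ?thesis by simp
qed

section \<open>Stirling polynomials as Taylor coefficients\<close>

lemma poly_pochhammer: "poly (pochhammer p k) z = pochhammer (poly p z) k"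
  for p :: "complex poly"
  by (induction k) (simp_all add: pochhammer_Suc of_nat_poly)

lemma poly_eq_sum_atMost:
  fixes z :: complex
  assumes "degree p \<le> d"
  shows "poly p z = (\<Sum>i\<le>d. coeff p i * z ^ i)"
proof -
  have "poly p z = poly (\<Sum>i\<le>d. monom (coeff p i) i) z"
    using assms by (simp only: poly_as_sum_of_monoms')
  then show ?thesis
    by (simp add: poly_sum poly_monom)
qed

text \<open>
  The rising factorial \<open>(j+1)\<^sub>m\<close> as a polynomial in \<open>y = j + x\<close>; its coefficient of \<open>y\<^sup>m\<^sup>-\<^sup>k\<close> is
  \<open>(-1)\<^sup>k P\<^sub>k(m, x)\<close>.
\<close>

definition shifted_pochhammer_poly :: "nat \<Rightarrow> complex \<Rightarrow> complex poly" where
  "shifted_pochhammer_poly m x = pcompose (pochhammer [:1, 1:] m) [:- x, 1:]"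

lemma poly_shifted_pochhammer_poly: "poly (shifted_pochhammer_poly m x) z = pochhammer (z - x + 1) m"
  by (simp add: shifted_pochhammer_poly_def poly_pcompose poly_pochhammer algebra_simps)

lemma shifted_pochhammer_poly_eq:
  "shifted_pochhammer_poly m x = (\<Sum>k\<le>m. monom ((-1) ^ k * stirling_poly k m x) (m - k))"
proof (rule poly_ext)
  fix z
  have "poly (shifted_pochhammer_poly m x) z
    = poly (\<Sum>k=0..m. smult ((-1) ^ k * stirling_poly k m x) ([:x, 1:] ^ (m - k))) (z - x)"
    using is_stirling_coeffs_stirling_poly(2) [of m x]
    by (simp add: is_stirling_coeffs_def shifted_pochhammer_poly_def poly_pcompose)
  also have "\<dots> = poly (\<Sum>k\<le>m. monom ((-1) ^ k * stirling_poly k m x) (m - k)) z"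
    by (simp add: poly_sum poly_monom poly_power atLeast0AtMost)
  finally show "poly (shifted_pochhammer_poly m x) z = \<dots>" .
qed

lemma degree_shifted_pochhammer_poly: "degree (shifted_pochhammer_poly m x) \<le> m"
  unfolding shifted_pochhammer_poly_eq
  by (intro degree_sum_le) (auto intro: order_trans [OF degree_monom_le])

text \<open>
  A sum against the \<open>P\<^sub>k\<close> is the linear functional \<open>y\<^sup>i \<mapsto> \<phi> i\<close> applied to the shifted rising
  factorial. In this form, multiplying the polynomial by \<open>y\<^sup>2 - c\<close> becomes a manipulation of \<open>\<phi>\<close>.
\<close>

lemma sum_stirling_poly:
  "(\<Sum>k=0..m. (-1) ^ k * stirling_poly k m x * \<phi> (m - k)) = (\<Sum>i\<le>m. coeff (shifted_pochhammer_poly m x) i * \<phi> i)"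
proof -
  have "(\<Sum>i\<le>m. coeff (shifted_pochhammer_poly m x) i * \<phi> i)
    = (\<Sum>i\<le>m. \<Sum>k\<le>m. if i = m - k then (-1) ^ k * stirling_poly k m x * \<phi> i else 0)"
    unfolding shifted_pochhammer_poly_eq
    by (auto simp: coeff_sum sum_distrib_right intro!: sum.cong)
  also have "\<dots> = (\<Sum>k\<le>m. \<Sum>i\<le>m. if i = m - k then (-1) ^ k * stirling_poly k m x * \<phi> i else 0)"
    by (rule sum.swap)
  also have "\<dots> = (\<Sum>k=0..m. (-1) ^ k * stirling_poly k m x * \<phi> (m - k))"
    by (simp add: sum.delta atLeast0AtMost)
  finally show ?thesis ..
qed

lemma sum_coeff_quadratic_mult:
  fixes Q :: "complex poly"
  assumes "degree Q \<le> d"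
  shows "(\<Sum>i\<le>d + 2. coeff ([:- c, 0, 1:] * Q) i * \<phi> i) = (\<Sum>i\<le>d. coeff Q i * \<phi> (i + 2)) - c * (\<Sum>i\<le>d. coeff Q i * \<phi> i)"
proof -
  have eq: "[:- c, 0, 1:] * Q = pCons 0 (pCons 0 Q) - smult c Q"
    by simp
  have 1: "(\<Sum>i\<le>d + 2. coeff (pCons 0 (pCons 0 Q)) i * \<phi> i) = (\<Sum>i\<le>d. coeff Q i * \<phi> (i + 2))"
    by (simp add: sum.atMost_Suc_shift numeral_2_eq_2 del: sum.atMost_Suc)
  have "(\<Sum>i\<le>d + 2. coeff Q i * \<phi> i) = (\<Sum>i\<le>d. coeff Q i * \<phi> i)"
    using assms by (simp add: numeral_2_eq_2 coeff_eq_0)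
  with 1 show ?thesis
    unfolding eq coeff_diff coeff_smult left_diff_distrib sum_subtractf
    by (simp add: mult.assoc del: sum.atMost_Suc flip: sum_distrib_left)
qed

lemma sum_stirling_poly_minus_half:
  "(\<Sum>k=0..m. (- 1 / 2) ^ k * stirling_poly k m x * \<psi> (m - k))
    = (\<Sum>i\<le>m. coeff (shifted_pochhammer_poly m x) i * (2 ^ i * \<psi> i)) / 2 ^ m"
proof -
  have "(\<Sum>k=0..m. (- 1 / 2) ^ k * stirling_poly k m x * \<psi> (m - k))
    = (\<Sum>k=0..m. (-1) ^ k * stirling_poly k m x * (2 ^ (m - k) * \<psi> (m - k) / 2 ^ m))"
  proof (rule sum.cong)
    fix k assume "k \<in> {0..m}"
    then have "(2::complex) ^ m = 2 ^ (m - k) * 2 ^ k"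
      by (simp flip: power_add)
    moreover have "(- 1 / 2 :: complex) ^ k = (-1) ^ k / 2 ^ k"
      by (rule power_divide)
    ultimately show "(- 1 / 2) ^ k * stirling_poly k m x * \<psi> (m - k)
      = (-1) ^ k * stirling_poly k m x * (2 ^ (m - k) * \<psi> (m - k) / 2 ^ m)"
      by simp
  qed simp
  also have "\<dots> = (\<Sum>i\<le>m. coeff (shifted_pochhammer_poly m x) i * (2 ^ i * \<psi> i / 2 ^ m))"
    by (rule sum_stirling_poly)
  finally show ?thesis
    by (simp add: sum_divide_distrib)
qed

section \<open>The identity\<close>

text \<open>
  With \<open>w = y - n/2\<close> the polynomials are \<open>(w)\<^sub>n\<^sub>+\<^sub>1\<close> and \<open>(w+1)\<^sub>n\<^sub>-\<^sub>1\<close>, which differ by the outer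
  factors \<open>w (w + n) = y\<^sup>2 - n\<^sup>2/4\<close>.
\<close>

lemma shifted_pochhammer_poly_quadratic:
  assumes n: "n \<ge> 1"
  shows "shifted_pochhammer_poly (n + 1) ((of_nat n + 2) / 2)
    = [:- ((of_nat n)\<^sup>2 / 4), 0, 1:] * shifted_pochhammer_poly (n - 1) (of_nat n / 2)"
proof (rule poly_ext)
  fix z :: complex
  define w where "w = z - of_nat n / 2"
  obtain k where k: "n = Suc k"
    using n by (cases n) auto
  have "pochhammer w (n + 1) = w * (w + of_nat n) * pochhammer (w + 1) (n - 1)"
  proof -
    have "pochhammer w (Suc (Suc k)) = w * (pochhammer (w + 1) k * (w + 1 + of_nat k))"
      by (simp only: pochhammer_rec [of w "Suc k"] pochhammer_Suc [of "w + 1" k])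
    then show ?thesis
      by (simp add: k algebra_simps)
  qed
  moreover have "z - (of_nat n + 2) / 2 + 1 = w"
    by (simp add: w_def field_simps)
  moreover have "w * (w + of_nat n) = z\<^sup>2 - (of_nat n)\<^sup>2 / 4"
    by (simp add: w_def field_simps power2_eq_square)
  ultimately have lhs: "poly (shifted_pochhammer_poly (n + 1) ((of_nat n + 2) / 2)) z
      = (z\<^sup>2 - (of_nat n)\<^sup>2 / 4) * pochhammer (w + 1) (n - 1)"
    by (simp only: poly_shifted_pochhammer_poly)
  have "poly ([:- ((of_nat n)\<^sup>2 / 4), 0, 1:] * shifted_pochhammer_poly (n - 1) (of_nat n / 2)) z
      = (z\<^sup>2 - (of_nat n)\<^sup>2 / 4) * pochhammer (w + 1) (n - 1)"
    by (simp add: poly_shifted_pochhammer_poly w_def power2_eq_square algebra_simps)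
  with lhs show "poly (shifted_pochhammer_poly (n + 1) ((of_nat n + 2) / 2)) z =
      poly ([:- ((of_nat n)\<^sup>2 / 4), 0, 1:] * shifted_pochhammer_poly (n - 1) (of_nat n / 2)) z"
    by simp
qed

text \<open>
  The sum is \<open>g(0)\<close> for the polynomial \<open>g\<close> that takes at \<open>t\<close> the same combination of the
  polynomials of \<open>hurwitz_zeta_diff_neg_of_nat\<close> with \<open>n/4\<close> replaced by \<open>n/4 + t/2\<close>; a unit step in
  \<open>t\<close> is then the half step of their difference equation.
\<close>

lemma alternating_zeta_moment_eq_0:
  assumes n: "n \<ge> 1"
  shows "(\<Sum>i\<le>n - 1. coeff (shifted_pochhammer_poly (n - 1) (of_nat n / 2)) i *
    (2 ^ i * hurwitz_zeta_diff (- of_nat (i + 1)) (of_real (real n / 4)) (of_real (real n / 4 + 1 / 2)))) = 0"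
proof -
  define Q where "Q = shifted_pochhammer_poly (n - 1) (of_nat n / 2)"
  have "\<exists>q. (\<forall>x>0. hurwitz_zeta_diff (- of_nat m) (of_real x) (of_real (x + 1 / 2)) = poly q (of_real x)) \<and>
    (\<forall>z. poly q z + poly q (z + 1 / 2) = z ^ m)" for m
    using hurwitz_zeta_diff_neg_of_nat [of m] by metis
  then obtain q where q: "\<And>m x. x > 0 \<Longrightarrow>
      hurwitz_zeta_diff (- of_nat m) (of_real x) (of_real (x + 1 / 2)) = poly (q m) (of_real x)"
    and q_rec: "\<And>m z. poly (q m) z + poly (q m) (z + 1 / 2) = z ^ m"
    by metis
  define g where "g = (\<Sum>i\<le>n - 1. smult (coeff Q i * 2 ^ i) (pcompose (q (i + 1)) [:of_nat n / 4, 1 / 2:]))"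
  have "poly g t + poly g (t + 1) = 1 / 2 * (pochhammer (t + 1) (n - 1) * (t + of_nat n / 2))" for t
  proof -
    define y where "y = t + of_nat n / 2"
    have half: "of_nat n / 4 + t / 2 = y / 2" "of_nat n / 4 + (t + 1) / 2 = y / 2 + 1 / 2"
      by (simp_all add: y_def field_simps)
    have "poly g t + poly g (t + 1) = (\<Sum>i\<le>n - 1. coeff Q i * 2 ^ i * (y / 2) ^ (i + 1))"
      unfolding q_rec [symmetric] g_def
      by (simp add: poly_sum poly_pcompose half distrib_left flip: sum.distrib)
    also have "\<dots> = (\<Sum>i\<le>n - 1. coeff Q i * y ^ i) * (y / 2)"
      unfolding sum_distrib_right by (intro sum.cong) (simp_all add: power_divide)
    also have "(\<Sum>i\<le>n - 1. coeff Q i * y ^ i) = poly Q y"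
      using degree_shifted_pochhammer_poly [of "n - 1" "of_nat n / 2"]
      by (simp add: poly_eq_sum_atMost Q_def)
    also have "poly Q y = pochhammer (t + 1) (n - 1)"
      by (simp add: Q_def poly_shifted_pochhammer_poly y_def)
    finally show ?thesis
      by (simp add: y_def)
  qed
  then have "poly g 0 = 0"
    by (rule alternating_sum_pochhammer_eq_0 [OF n])
  moreover have "poly g 0 = (\<Sum>i\<le>n - 1. coeff Q i *
      (2 ^ i * hurwitz_zeta_diff (- of_nat (i + 1)) (of_real (real n / 4)) (of_real (real n / 4 + 1 / 2))))"
    using n unfolding g_def by (subst q) (simp_all add: poly_sum poly_pcompose mult.assoc)
  ultimately show ?thesis
    by (simp add: Q_def)
qed

theorem lemma6:
  fixes n :: nat
  assumes "n \<ge> 1"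
  shows "2 ^ (2 * n + 1) / fact (n - 1) *
    ((of_nat n)\<^sup>2 / 16 *
       (\<Sum>k=0..n-1. (- 1 / 2) ^ k * stirling_poly k (n - 1) (of_nat n / 2) *
          hurwitz_zeta_diff (of_nat k - of_nat n + 2) (of_nat n / 4) ((of_nat n + 2) / 4)) -
     (\<Sum>k=0..n+1. (- 1 / 2) ^ k * stirling_poly k (n + 1) ((of_nat n + 2) / 2) *
          hurwitz_zeta_diff (of_nat k - of_nat n) ((of_nat n + 2) / 4) ((of_nat n + 4) / 4)))
    = (0 :: complex)"
proof -
  define x where "x = real n / 4"
  have x: "x > 0" and x_eq: "of_nat n / 4 = complex_of_real x"
    "(of_nat n + 2) / 4 = complex_of_real (x + 1 / 2)" "(of_nat n + 4) / 4 = complex_of_real (x + 1)"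
    using assms by (simp_all add: x_def field_simps)
  define \<phi> where "\<phi> i = hurwitz_zeta_diff (1 - of_nat i) (of_real x) (of_real (x + 1 / 2))" for i :: nat
  define \<psi> where "\<psi> i = hurwitz_zeta_diff (1 - of_nat i) (of_real (x + 1 / 2)) (of_real (x + 1))" for i :: nat
  define Q where "Q = shifted_pochhammer_poly (n - 1) (of_nat n / 2)"
  define R where "R = shifted_pochhammer_poly (n + 1) ((of_nat n + 2) / 2)"
  define \<Lambda> where "\<Lambda> = (\<Sum>i\<le>n - 1. coeff Q i * (2 ^ i * \<phi> i))"
  have RQ: "R = [:- ((of_nat n)\<^sup>2 / 4), 0, 1:] * Q"
    unfolding R_def Q_def by (rule shifted_pochhammer_poly_quadratic [OF assms])

  have S1: "(\<Sum>k=0..n-1. (- 1 / 2) ^ k * stirling_poly k (n - 1) (of_nat n / 2) *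
      hurwitz_zeta_diff (of_nat k - of_nat n + 2) (of_nat n / 4) ((of_nat n + 2) / 4)) = \<Lambda> / 2 ^ (n - 1)"
  proof -
    have "hurwitz_zeta_diff (of_nat k - of_nat n + 2) (of_nat n / 4) ((of_nat n + 2) / 4) = \<phi> (n - 1 - k)"
      if "k \<in> {0..n - 1}" for k
    proof -
      have "of_nat k - of_nat n + 2 = 1 - complex_of_nat (n - 1 - k)"
        using that assms by (simp add: of_nat_diff)
      then show ?thesis
        by (simp only: \<phi>_def x_eq)
    qed
    then show ?thesis
      unfolding \<Lambda>_def Q_def sum_stirling_poly_minus_half [symmetric] by simp
  qed
  have S2: "(\<Sum>k=0..n+1. (- 1 / 2) ^ k * stirling_poly k (n + 1) ((of_nat n + 2) / 2) *
      hurwitz_zeta_diff (of_nat k - of_nat n) ((of_nat n + 2) / 4) ((of_nat n + 4) / 4))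
    = (\<Sum>i\<le>n + 1. coeff R i * (2 ^ i * \<psi> i)) / 2 ^ (n + 1)"
  proof -
    have "hurwitz_zeta_diff (of_nat k - of_nat n) ((of_nat n + 2) / 4) ((of_nat n + 4) / 4) = \<psi> (n + 1 - k)"
      if "k \<in> {0..n + 1}" for k
    proof -
      have "of_nat k - of_nat n = 1 - complex_of_nat (n + 1 - k)"
        using that by (simp add: of_nat_diff)
      then show ?thesis
        by (simp only: \<psi>_def x_eq)
    qed
    then show ?thesis
      unfolding R_def sum_stirling_poly_minus_half [symmetric] by simp
  qed

  \<comment> \<open>The shift of the summation index in the second series: up to a boundary term, \<open>\<psi>\<close> is \<open>- \<phi>\<close>.\<close>
  have \<psi>: "2 ^ i * \<psi> i = (of_nat n / 2) ^ i / of_real x - 2 ^ i * \<phi> i" for i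
  proof -
    have "\<phi> i + \<psi> i = of_real x powr (of_nat i - 1)"
      using hurwitz_zeta_diff_shift [OF x, of "x + 1 / 2" "1 - of_nat i"] x by (simp add: \<phi>_def \<psi>_def)
    also have "\<dots> = of_real x ^ i / of_real x"
      using x by (simp add: powr_diff powr_nat')
    finally have "2 ^ i * (\<phi> i + \<psi> i) = (2 * of_real x) ^ i / of_real x"
      by (simp add: power_mult_distrib)
    also have "2 * complex_of_real x = of_nat n / 2"
      by (simp add: x_def)
    finally show ?thesis
      by (simp only: distrib_left eq_diff_eq add.commute)
  qed
  \<comment> \<open>The boundary terms add up to the value of \<open>R\<close> at its zero \<open>n/2\<close>, the vanishing term \<open>j = 0\<close>.\<close>
  have "(\<Sum>i\<le>n + 1. coeff R i * (of_nat n / 2) ^ i) = poly R (of_nat n / 2)"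
    using degree_shifted_pochhammer_poly [of "n + 1" "(of_nat n + 2) / 2"]
    unfolding R_def by (rule poly_eq_sum_atMost [symmetric])
  also have "\<dots> = 0"
    by (simp add: RQ power2_eq_square)
  finally have zero: "(\<Sum>i\<le>n + 1. coeff R i * (of_nat n / 2) ^ i) = 0" .
  have "(\<Sum>i\<le>n + 1. coeff R i * (2 ^ i * \<psi> i))
      = (\<Sum>i\<le>n + 1. coeff R i * (of_nat n / 2) ^ i) / of_real x - (\<Sum>i\<le>n + 1. coeff R i * (2 ^ i * \<phi> i))"
    unfolding \<psi> right_diff_distrib sum_subtractf sum_divide_distrib times_divide_eq_right ..
  also have "\<dots> = - (\<Sum>i\<le>n - 1 + 2. coeff R i * (2 ^ i * \<phi> i))"
    using assms unfolding zero by (simp del: sum.atMost_Suc)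
  also have "(\<Sum>i\<le>n - 1 + 2. coeff R i * (2 ^ i * \<phi> i))
      = (\<Sum>i\<le>n - 1. coeff Q i * (2 ^ (i + 2) * \<phi> (i + 2))) - (of_nat n)\<^sup>2 / 4 * \<Lambda>"
    unfolding RQ \<Lambda>_def by (rule sum_coeff_quadratic_mult) (simp add: Q_def degree_shifted_pochhammer_poly)
  also have "(\<Sum>i\<le>n - 1. coeff Q i * (2 ^ (i + 2) * \<phi> (i + 2)))
      = 4 * (\<Sum>i\<le>n - 1. coeff Q i * (2 ^ i * hurwitz_zeta_diff (- of_nat (i + 1)) (of_real x) (of_real (x + 1 / 2))))"
    unfolding sum_distrib_left \<phi>_def by (intro sum.cong) (simp_all add: algebra_simps)
  also have "\<dots> = 0"
    using alternating_zeta_moment_eq_0 [OF assms] by (simp only: x_def Q_def mult_zero_right)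
  finally have moment: "(\<Sum>i\<le>n + 1. coeff R i * (2 ^ i * \<psi> i)) = (of_nat n)\<^sup>2 / 4 * \<Lambda>"
    by simp
  have pow: "(2::complex) ^ (n + 1) = 4 * 2 ^ (n - 1)"
    using assms by (cases n) auto
  show ?thesis
    unfolding S1 S2 moment pow by simp
qed

end
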